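(* Let $I$ be a finite set and $T$ a tree on $I$. For $i\in I$, define the polynomial vector field on $\mathbb{C}^I$ $$\theta_i=\sum_{j\geq_T i}\Big(\prod_{k<_T i}(x_k-x_j)\Big)\partial_j .$$ Then, for every $i\in I$, $\theta_i$ belongs to $\operatorname{Der}(H_T)$.
   Context: A tree on a finite set $I$ is a labeled rooted tree with vertex set $I$; equivalently, a partial order $\leq_T$ on $I$ with a unique minimal element (the root) such that the interval between the root and any element is a chain. $\mathbb{C}^I$ has coordinates $x_i$, and $\partial_j=\partial/\partial x_j$. $H_T$ is the hyperplane arrangement in $\mathbb{C}^I$ consisting of the hyperplanes $x_i=x_j$ for $i<_T j$. $\operatorname{Der}(H_T)$ is the space of logarithmic vector fields: polynomial vector fields $\theta$ on $\mathbb{C}^I$ such that $\alpha$ divides $\theta(\alpha)$ for each linear form $\alpha=x_i-x_j$ with $i<_T j$. *)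

theory Defs
  imports Complex_Main "HOL-Library.Poly_Mapping"
begin

text \<open>
  The finite set I is the universe of a finite type \<open>'i\<close>. Polynomial functions on the space of
  complex vectors indexed by I are represented by the polynomial ring in the variables \<open>x_i\<close>:
  finitely supported maps from exponent vectors to coefficients, with convolution as product.
\<close>

type_synonym 'i cpoly = "('i \<Rightarrow>\<^sub>0 nat) \<Rightarrow>\<^sub>0 complex"

definition Var :: "'i \<Rightarrow> 'i cpoly" where
  "Var i = Poly_Mapping.single (Poly_Mapping.single i 1) 1"

text \<open>
  The derivative of \<open>c x^m\<close> in direction j is \<open>c m_j x^(m - e_j)\<close>; the difference of exponents is
  truncated, but where truncation occurs the coefficient \<open>m_j\<close> is zero.
\<close>

definition partial :: "'i \<Rightarrow> 'i cpoly \<Rightarrow> 'i cpoly" where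
  "partial j p = (\<Sum>m\<in>Poly_Mapping.keys p.
     Poly_Mapping.single (m - Poly_Mapping.single j 1)
       (of_nat (Poly_Mapping.lookup m j) * Poly_Mapping.lookup p m))"

text \<open>A vector field is viewed as an operator on polynomials, so that \<open>\<theta> \<alpha>\<close> is application.\<close>

definition poly_vector_fields :: "('i::finite cpoly \<Rightarrow> 'i cpoly) set" where
  "poly_vector_fields = {\<lambda>p. \<Sum>j\<in>UNIV. f j * partial j p | f. True}"

text \<open>The pair \<open>(i, j) \<in> T\<close> means that i is below or equal to j, the root being least.\<close>

definition is_tree :: "'i rel \<Rightarrow> bool" where
  "is_tree T \<longleftrightarrow> partial_order_on UNIV T
     \<and> (\<exists>!r. \<forall>k. (k, r) \<in> T \<longrightarrow> k = r)
     \<and> (\<forall>r. (\<forall>k. (k, r) \<in> T \<longrightarrow> k = r) \<longrightarrow>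
          (\<forall>j. {k. (r, k) \<in> T \<and> (k, j) \<in> T} \<in> Chains T))"

text \<open>An arrangement is given by the set of linear forms that define its hyperplanes.\<close>

definition tree_arrangement :: "'i rel \<Rightarrow> 'i cpoly set" where
  "tree_arrangement T = {Var i - Var j | i j. (i, j) \<in> T \<and> i \<noteq> j}"

definition Der :: "'i::finite cpoly set \<Rightarrow> ('i cpoly \<Rightarrow> 'i cpoly) set" where
  "Der H = {\<theta> \<in> poly_vector_fields. \<forall>\<alpha>\<in>H. \<alpha> dvd \<theta> \<alpha>}"

definition tree_field :: "'i::finite rel \<Rightarrow> 'i \<Rightarrow> 'i cpoly \<Rightarrow> 'i cpoly" where
  "tree_field T i = (\<lambda>p. \<Sum>j\<in>{j. (i, j) \<in> T}.
     (\<Prod>k\<in>{k. (k, i) \<in> T \<and> k \<noteq> i}. Var k - Var j) * partial j p)"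

text \<open>\<open>partial j\<close> is additive, satisfies the Leibniz rule, and has the expected values on variables.\<close>

lemma partial_superset:
  assumes "finite A" "Poly_Mapping.keys p \<subseteq> A"
  shows "partial j p = (\<Sum>m\<in>A. Poly_Mapping.single (m - Poly_Mapping.single j 1)
       (of_nat (Poly_Mapping.lookup m j) * Poly_Mapping.lookup p m))"
  unfolding partial_def using assms
  by (intro sum.mono_neutral_left) (auto simp: in_keys_iff)

lemma partial_single:
  "partial j (Poly_Mapping.single m c)
     = Poly_Mapping.single (m - Poly_Mapping.single j 1) (of_nat (Poly_Mapping.lookup m j) * c)"
  by (subst partial_superset[of "{m}"]) auto

lemma partial_Var: "partial j (Var i) = (if i = j then 1 else 0)"
  by (auto simp: Var_def partial_single lookup_single)

lemma partial_add: "partial j (p + q) = partial j p + partial j q"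
proof -
  let ?A = "Poly_Mapping.keys p \<union> Poly_Mapping.keys q"
  have "Poly_Mapping.keys (p + q) \<subseteq> ?A" by (rule keys_add)
  then show ?thesis
    by (simp add: partial_superset[of ?A] lookup_add single_add distrib_left sum.distrib)
qed

lemma poly_add_single_induct:
  fixes p :: "'i cpoly"
  assumes "P 0" "\<And>p m c. P p \<Longrightarrow> P (Poly_Mapping.single m c + p)"
  shows "P p"
proof (induction p rule: update_induct)
  case const
  then show ?case using assms(1) by simp
next
  case (update f a b)
  have "Poly_Mapping.update a b f = Poly_Mapping.single a b + f"
    using update(1)
    by (intro poly_mapping_eqI) (auto simp: lookup_add lookup_update lookup_single in_keys_iff when_def)
  then show ?case using assms(2) update by simp
qed

lemma partial_mult: "partial j (p * q) = partial j p * q + p * partial j q"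
proof -
  have zero: "partial j 0 = 0" for j :: 'a by (simp add: partial_def)
  have eq: "a - Poly_Mapping.single j 1 + b = a + b - Poly_Mapping.single j (1::nat)"
    if "Poly_Mapping.lookup a j \<noteq> 0" for a b :: "'a \<Rightarrow>\<^sub>0 nat"
    using that
    by (intro poly_mapping_eqI) (auto simp: lookup_add lookup_minus lookup_single when_def)
  have mono: "partial j (Poly_Mapping.single a c * Poly_Mapping.single b d)
      = partial j (Poly_Mapping.single a c) * Poly_Mapping.single b d
        + Poly_Mapping.single a c * partial j (Poly_Mapping.single b d)" for a b c d
  proof -
    have e1: "Poly_Mapping.lookup a j = 0 \<or>
        a - Poly_Mapping.single j 1 + b = a + b - Poly_Mapping.single j 1" using eq[of a b] by blast
    have e2: "Poly_Mapping.lookup b j = 0 \<or>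
        a + (b - Poly_Mapping.single j 1) = a + b - Poly_Mapping.single j 1"
      using eq[of b a] by (metis add.commute)
    show ?thesis using e1 e2
      by (auto simp: mult_single partial_single lookup_add single_add[symmetric] algebra_simps
          simp del: One_nat_def)
  qed
  have single: "partial j (Poly_Mapping.single a c * q)
      = partial j (Poly_Mapping.single a c) * q + Poly_Mapping.single a c * partial j q" for a c
    by (induction q rule: poly_add_single_induct)
       (simp_all add: zero partial_add distrib_left mono algebra_simps)
  show ?thesis
    by (induction p rule: poly_add_single_induct)
       (simp_all add: zero partial_add distrib_right single add.assoc add.left_commute)
qed

end

theory Submission
  imports Defs
begin

text \<open>
  For \<open>a < b\<close> write \<open>P j\<close> for the coefficient of \<open>\<theta>\<^sub>i\<close> at \<open>j\<close>. If \<open>i \<le> a\<close>, the value of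
  \<open>\<theta>\<^sub>i\<close> on \<open>x\<^sub>a - x\<^sub>b\<close> is \<open>P a - P b\<close>, and the factors of \<open>P a\<close> and \<open>P b\<close> agree modulo
  \<open>x\<^sub>a - x\<^sub>b\<close>. If only \<open>i \<le> b\<close>, then \<open>a\<close> and \<open>i\<close> are comparable, being both below \<open>b\<close>,
  so \<open>a < i\<close> and \<open>x\<^sub>a - x\<^sub>b\<close> is itself a factor of \<open>P b\<close>. Otherwise the value is zero.
\<close>

lemma partial_diff: "partial j (p - q) = partial j p - partial j q"
  using partial_add[of j "p - q" q] by (simp add: algebra_simps)

text \<open>Congruence modulo \<open>d\<close> is multiplicative: exchange one factor at a time. For
  infinite \<open>A\<close> both products are 1.\<close>

lemma dvd_diff_prod:
  fixes f g :: "'a \<Rightarrow> 'b::comm_ring_1"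
  assumes "\<And>k. k \<in> A \<Longrightarrow> d dvd f k - g k"
  shows "d dvd prod f A - prod g A"
  using assms
proof (induction A rule: infinite_finite_induct)
  case (insert k A)
  have "prod f (insert k A) - prod g (insert k A)
      = (f k - g k) * prod f A + g k * (prod f A - prod g A)"
    using insert.hyps by (simp add: algebra_simps)
  then show ?case
    using insert by (metis dvd_add dvd_mult dvd_mult2 insert_iff)
qed simp_all

text \<open>The strict part of a finite order is acyclic, hence well-founded. A minimal element of
  the down-set of \<open>j\<close> is minimal globally, since by transitivity anything below it is
  again below \<open>j\<close>.\<close>

lemma partial_order_on_ex_minimal_below:
  fixes T :: "'i::finite rel"
  assumes "partial_order_on UNIV T"
  shows "\<exists>r. (r, j) \<in> T \<and> (\<forall>k. (k, r) \<in> T \<longrightarrow> k = r)"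
proof -
  have refl: "(k, k) \<in> T" for k
    using assms by (auto simp: partial_order_on_def preorder_on_def refl_on_def)
  have trans: "trans T" and anti: "antisym T"
    using assms by (auto simp: partial_order_on_def preorder_on_def)
  have "acyclic (T - Id)"
    using acyclicI[of "T - Id"] trancl_id[OF trans_diff_Id[OF trans anti]] by auto
  then have "wf (T - Id)"
    by (simp add: finite_acyclic_wf)
  then obtain r where r: "(r, j) \<in> T" "\<And>k. (k, r) \<in> T - Id \<Longrightarrow> (k, j) \<notin> T"
    using refl by (elim wfE_min[of _ j "{k. (k, j) \<in> T}"]) auto
  then show ?thesis
    using trans by (meson DiffI IdE pair_in_Id_conv transD)
qed

text \<open>Minimal elements below \<open>a\<close> and \<open>c\<close> both equal the root, so
  \<open>a\<close> and \<open>c\<close> lie in the interval from the root to \<open>b\<close>, which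
  is a chain.\<close>

lemma is_tree_comparable:
  fixes T :: "'i::finite rel"
  assumes "is_tree T" "(a, b) \<in> T" "(c, b) \<in> T"
  shows "(a, c) \<in> T \<or> (c, a) \<in> T"
proof -
  have order: "partial_order_on UNIV T"
    using assms by (simp add: is_tree_def)
  obtain r where r: "(r, a) \<in> T" "\<forall>k. (k, r) \<in> T \<longrightarrow> k = r"
    using partial_order_on_ex_minimal_below[OF order] by blast
  obtain s where s: "(s, c) \<in> T" "\<forall>k. (k, s) \<in> T \<longrightarrow> k = s"
    using partial_order_on_ex_minimal_below[OF order] by blast
  have "s = r"
    using assms(1) r(2) s(2) unfolding is_tree_def by blast
  moreover have "{k. (r, k) \<in> T \<and> (k, b) \<in> T} \<in> Chains T"
    using assms(1) r(2) by (simp add: is_tree_def)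
  ultimately show ?thesis
    using assms r(1) s(1) by (auto simp: Chains_def)
qed

lemma tree_field_in_poly_vector_fields: "tree_field T i \<in> poly_vector_fields"
proof -
  \<comment> \<open>Coefficients are extended by zero to indices not above \<open>i\<close>.\<close>
  have "tree_field T i = (\<lambda>p. \<Sum>j\<in>UNIV.
      (if (i, j) \<in> T then \<Prod>k\<in>{k. (k, i) \<in> T \<and> k \<noteq> i}. Var k - Var j else 0) * partial j p)"
    unfolding tree_field_def by (intro ext sum.mono_neutral_cong_left) auto
  then show ?thesis
    unfolding poly_vector_fields_def by (intro CollectI exI conjI TrueI)
qed

lemma tree_field_diff: "tree_field T i (p - q) = tree_field T i p - tree_field T i q"
  by (simp add: tree_field_def partial_diff right_diff_distrib sum_subtractf)

lemma tree_field_Var: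
  "tree_field T i (Var a) =
    (if (i, a) \<in> T then \<Prod>k\<in>{k. (k, i) \<in> T \<and> k \<noteq> i}. Var k - Var a else 0)"
  by (simp add: tree_field_def partial_Var if_distrib[of "(*) _"] sum.delta cong: if_cong)

theorem proposition1:
  fixes T :: "'i::finite rel" and i :: 'i
  assumes "is_tree T"
  shows "tree_field T i \<in> Der (tree_arrangement T)"
proof -
  let ?P = "\<lambda>j. \<Prod>k\<in>{k. (k, i) \<in> T \<and> k \<noteq> i}. Var k - Var j :: 'i cpoly"
  have "Var a - Var b dvd tree_field T i (Var a - Var b)"
    if ab: "(a, b) \<in> T" "a \<noteq> b" for a b
  proof (cases "(i, a) \<in> T")
    case True
    have "trans T"
      using assms by (simp add: is_tree_def partial_order_on_def preorder_on_def)
    then have "(i, b) \<in> T"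
      using True ab(1) by (meson transD)
    \<comment> \<open>The cofactor \<open>-1\<close> comes from
      \<open>(Var k - Var a) - (Var k - Var b) = - (Var a - Var b)\<close>.\<close>
    moreover have "Var a - Var b dvd ?P a - ?P b"
      by (rule dvd_diff_prod) (simp add: dvd_def exI[of _ "-1"])
    ultimately show ?thesis
      using True by (simp add: tree_field_diff tree_field_Var)
  next
    case ia: False
    show ?thesis
    proof (cases "(i, b) \<in> T")
      case True
      then have ai: "(a, i) \<in> T" "a \<noteq> i"
        using is_tree_comparable[OF assms ab(1) True] ia by auto
      then have "Var a - Var b dvd ?P b"
        by (intro dvd_prodI) auto
      then show ?thesis
        using True ia by (simp add: tree_field_diff tree_field_Var)
    next
      case False
      then show ?thesis
        using ia by (simp add: tree_field_diff tree_field_Var)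
    qed
  qed
  then show ?thesis
    by (auto simp: Der_def tree_arrangement_def tree_field_in_poly_vector_fields)
qed

end
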